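(* Let $a<b$ be positive coprime integers. Then the number $N_{a,b}(n)$ of $(a,b)$-necklaces of length $n$ satisfies a linear homogeneous recurrence relation in $n$ of fixed order with integer coefficients; that is, there exist integers $d \ge 1$, $n_0$ and $c_1,\ldots,c_d$ (depending only on $a,b$) such that $N_{a,b}(n) = \sum_{i=1}^{d} c_i N_{a,b}(n-i)$ for all $n \ge n_0$.
   Context: For positive integers $a<b$ and $n \ge 3$, an $(a,b)$-necklace of length $n$ is a circular arrangement of the integers $0,1,\ldots,n-1$ (each used exactly once) such that any two adjacent entries have difference $\pm a$ or $\pm b$. Two necklaces are considered the same if one is obtained from the other by rotation or reflection of the circular arrangement. $N_{a,b}(n)$ denotes the number of distinct $(a,b)$-necklaces of length $n$; equivalently, it is the number of Hamiltonian cycles (as undirected subgraphs) of the graph $G_{a,b}(n)$ with vertex set $\{0,1,\ldots,n-1\}$ in which $x,y$ are adjacent if and only if $|x-y| \in \{a,b\}$. *)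

theory Defs
  imports Main
begin

text \<open>Circular arrangements of \<open>0, \<dots>, n - 1\<close>, cut open at some position: the
  last entry of the list is adjacent to the first one.  Only lengths \<open>n \<ge> 3\<close> are meaningful.\<close>

definition arrangements :: "nat \<Rightarrow> nat \<Rightarrow> nat \<Rightarrow> nat list set" where
  "arrangements a b n =
     {xs. distinct xs \<and> set xs = {0..<n} \<and>
          (\<forall>i<n. \<bar>int (xs ! i) - int (xs ! ((i + 1) mod n))\<bar> \<in> {int a, int b})}"

definition same_necklace :: "nat \<Rightarrow> nat \<Rightarrow> nat \<Rightarrow> (nat list \<times> nat list) set" where
  "same_necklace a b n =
     {(xs, ys). xs \<in> arrangements a b n \<and> ys \<in> arrangements a b n \<and>
                (\<exists>k. ys = rotate k xs \<or> ys = rotate k (rev xs))}"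

definition necklaces :: "nat \<Rightarrow> nat \<Rightarrow> nat \<Rightarrow> nat list set set" where
  "necklaces a b n = arrangements a b n // same_necklace a b n"

definition num_necklaces :: "nat \<Rightarrow> nat \<Rightarrow> nat \<Rightarrow> nat" where
  "num_necklaces a b n = card (necklaces a b n)"

lemma rotate_inverse: "\<exists>k'. rotate k' (rotate k xs) = xs"
proof (cases "xs = []")
  case False
  have "rotate (length xs - k mod length xs) (rotate (k mod length xs) xs) = xs"
    using False by (simp add: rotate_rotate less_imp_le)
  then show ?thesis by (metis rotate_conv_mod)
qed simp

lemma rev_rotate_ex: "\<exists>k'. rev (rotate k xs) = rotate k' (rev xs)"
proof -
  obtain k' where "rotate k' (rotate k xs) = xs" using rotate_inverse by blast
  then show ?thesis by (metis rotate_rev rev_rev_ident)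
qed

lemma equiv_same_necklace: "equiv (arrangements a b n) (same_necklace a b n)"
proof (rule equivI)
  show "same_necklace a b n \<subseteq> arrangements a b n \<times> arrangements a b n"
    by (auto simp: same_necklace_def)
  show "refl_on (arrangements a b n) (same_necklace a b n)"
    by (auto simp: refl_on_def same_necklace_def intro: exI[of _ 0])
  show "sym (same_necklace a b n)"
  proof (rule symI)
    fix xs ys assume *: "(xs, ys) \<in> same_necklace a b n"
    then obtain k where "ys = rotate k xs \<or> ys = rotate k (rev xs)"
      by (auto simp: same_necklace_def)
    then have "\<exists>k. xs = rotate k ys \<or> xs = rotate k (rev ys)"
      by (metis rotate_inverse rev_rotate_ex rev_rev_ident)
    with * show "(ys, xs) \<in> same_necklace a b n" by (auto simp: same_necklace_def)
  qed
  show "trans (same_necklace a b n)"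
  proof (rule transI)
    fix xs ys zs
    assume *: "(xs, ys) \<in> same_necklace a b n" "(ys, zs) \<in> same_necklace a b n"
    then obtain k l where "ys = rotate k xs \<or> ys = rotate k (rev xs)"
        "zs = rotate l ys \<or> zs = rotate l (rev ys)"
      by (auto simp: same_necklace_def)
    then have "\<exists>k. zs = rotate k xs \<or> zs = rotate k (rev xs)"
      by (metis rotate_rotate rev_rotate_ex rev_rev_ident)
    with * show "(xs, zs) \<in> same_necklace a b n" by (auto simp: same_necklace_def)
  qed
qed

end

theory Submission
  imports Defs "HOL-Computational_Algebra.Polynomial_FPS" "HOL-Combinatorics.Orbits"
begin

text \<open>For \<open>n \<ge> 3\<close> and \<open>n > b\<close> the vertex \<open>0\<close> of a necklace has neighbours \<open>a\<close> and \<open>b\<close>. Traverse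
  the necklace from \<open>0\<close> towards \<open>a\<close> and let \<open>w ! v\<close> be the successor of \<open>v\<close> minus \<open>v\<close>.
  Necklaces thereby become the words \<open>w\<close> over \<open>{a, b, -a, -b}\<close> that start with \<open>a\<close> and whose
  relation \<open>v \<mapsto> v + w ! v\<close> is strongly connected on \<open>{0..<n}\<close>. Strong connectivity is recognised
  by a finite automaton reading \<open>w\<close> from left to right: all steps have length at most \<open>b\<close>, so it
  suffices to remember reachability between the vertices at distance at most \<open>b\<close> from the current
  position, and whether all earlier vertices are linked in both directions to the last \<open>b\<close> ones.
  The generating functions of the states solve a linear system with coefficients in
  \<open>X \<int>[X]\<close>; eliminating the unknowns one by one only inverts series with constant term \<open>1\<close>, hence
  every solution has the form \<open>p / q\<close> with integer polynomials \<open>p\<close>, \<open>q\<close> and \<open>q(0) = 1\<close>, which is a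
  recurrence with integer coefficients.\<close>

subsection \<open>Rational power series over the integers\<close>

text \<open>The normalisation \<open>coeff q 0 = 1\<close> makes the denominator a unit among the
  integer power series, and it lets the resulting recurrence be solved for its leading term without
  division.\<close>

definition rational_fps :: "int fps \<Rightarrow> bool" where
  "rational_fps f \<longleftrightarrow> (\<exists>p q. coeff q 0 = 1 \<and> fps_of_poly q * f = fps_of_poly p)"

lemma rational_fps_poly: "rational_fps (fps_of_poly p)"
  unfolding rational_fps_def by (intro exI[of _ p] exI[of _ 1]) simp

lemma rational_fps_of_nat: "rational_fps (of_nat n)"
  using rational_fps_poly[of "[:of_nat n:]"] by (simp add: fps_of_poly_const fps_of_nat)

lemma rational_fps_X: "rational_fps fps_X"
  using rational_fps_poly[of "monom 1 1"] by (simp add: fps_of_poly_monom')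

lemma rational_fps_add:
  assumes "rational_fps f" "rational_fps g"
  shows "rational_fps (f + g)"
proof -
  obtain p q r s where "coeff q 0 = 1" "coeff s 0 = 1"
    and f: "fps_of_poly q * f = fps_of_poly p" and g: "fps_of_poly s * g = fps_of_poly r"
    using assms unfolding rational_fps_def by blast
  moreover have "fps_of_poly (q * s) * (f + g)
      = fps_of_poly s * (fps_of_poly q * f) + fps_of_poly q * (fps_of_poly s * g)"
    by (simp add: fps_of_poly_mult algebra_simps)
  then have "fps_of_poly (q * s) * (f + g) = fps_of_poly (s * p + q * r)"
    by (simp only: f g fps_of_poly_mult fps_of_poly_add)
  ultimately show ?thesis
    unfolding rational_fps_def by (intro exI[of _ "s * p + q * r"] exI[of _ "q * s"]) (simp add: coeff_mult)
qed

lemma rational_fps_mult: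
  assumes "rational_fps f" "rational_fps g"
  shows "rational_fps (f * g)"
proof -
  obtain p q r s where "coeff q 0 = 1" "coeff s 0 = 1"
    and f: "fps_of_poly q * f = fps_of_poly p" and g: "fps_of_poly s * g = fps_of_poly r"
    using assms unfolding rational_fps_def by blast
  moreover have "fps_of_poly (q * s) * (f * g) = (fps_of_poly q * f) * (fps_of_poly s * g)"
    by (simp add: fps_of_poly_mult algebra_simps)
  then have "fps_of_poly (q * s) * (f * g) = fps_of_poly (p * r)"
    by (simp only: f g fps_of_poly_mult)
  ultimately show ?thesis
    unfolding rational_fps_def by (intro exI[of _ "p * r"] exI[of _ "q * s"]) (simp add: coeff_mult)
qed

lemma rational_fps_sum: "(\<And>x. x \<in> S \<Longrightarrow> rational_fps (f x)) \<Longrightarrow> rational_fps (\<Sum>x\<in>S. f x)"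
  using rational_fps_of_nat[of 0]
  by (induction S rule: infinite_finite_induct) (auto intro: rational_fps_add)

text \<open>If \<open>g = p / q\<close>, then \<open>1 - g = (q - p) / q\<close> and hence
  \<open>f = q / (q - p)\<close>. Since \<open>g\<close> has constant term 0, so has
  \<open>p\<close>, and the new denominator keeps constant term 1.\<close>

lemma rational_fps_right_inverse:
  assumes "rational_fps g" "fps_nth g 0 = 0" "(1 - g) * f = 1"
  shows "rational_fps f"
proof -
  obtain p q where q: "coeff q 0 = 1" and g: "fps_of_poly q * g = fps_of_poly p"
    using assms(1) unfolding rational_fps_def by blast
  have "coeff p 0 = 0"
    using arg_cong[OF g, of "\<lambda>h. fps_nth h 0"] assms(2) by simp
  moreover have "fps_of_poly (q - p) * f = fps_of_poly q * ((1 - g) * f)"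
    by (simp add: fps_of_poly_diff g[symmetric] algebra_simps)
  ultimately show ?thesis
    unfolding rational_fps_def
    by (intro exI[of _ q] exI[of _ "q - p"]) (simp add: q assms(3))
qed

text \<open>Gaussian elimination by induction on the set of unknowns. The equation for
  \<open>F s\<close> is solved by inverting \<open>1 - A s s\<close>, whose constant term is 1;
  substituting the result into the other equations leaves a smaller system of the same
  shape.\<close>

lemma rational_fps_linear_system:
  assumes "finite S"
    and "\<And>q. q \<in> S \<Longrightarrow> rational_fps (p q)"
    and "\<And>q r. q \<in> S \<Longrightarrow> r \<in> S \<Longrightarrow> rational_fps (A q r) \<and> fps_nth (A q r) 0 = 0"
    and "\<And>q. q \<in> S \<Longrightarrow> F q = p q + (\<Sum>r\<in>S. A q r * F r)"
  shows "\<forall>q\<in>S. rational_fps (F q)"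
  using assms
proof (induction S arbitrary: p A rule: finite_induct)
  case (insert s S)
  \<comment> \<open>The integers are not a field, so the inverse series is built from an explicit
    inverse of the constant term, here 1.\<close>
  define g where "g = fps_right_inverse (1 - A s s) 1"
  have A: "rational_fps (A q r)" "fps_nth (A q r) 0 = 0"
    if "q \<in> insert s S" "r \<in> insert s S" for q r
    using insert.prems(2) that by blast+
  have g: "(1 - A s s) * g = 1"
    unfolding g_def by (rule fps_right_inverse) (simp add: A)
  have rat_g: "rational_fps g"
    by (rule rational_fps_right_inverse[OF A g]) auto
  have "(1 - A s s) * F s = p s + (\<Sum>r\<in>S. A s r * F r)"
    using insert.prems(3)[of s] insert.hyps by (simp add: algebra_simps)
  then have "g * ((1 - A s s) * F s) = g * (p s + (\<Sum>r\<in>S. A s r * F r))"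
    by simp
  then have Fs: "F s = g * p s + (\<Sum>r\<in>S. g * A s r * F r)"
    using g by (simp add: mult.assoc[symmetric] mult.commute[of g] distrib_left sum_distrib_left)
  have rat_S: "\<forall>q\<in>S. rational_fps (F q)"
  proof (rule insert.IH)
    fix q assume q: "q \<in> S"
    show "rational_fps (p q + A q s * (g * p s))"
      using q by (intro rational_fps_add rational_fps_mult rat_g A insert.prems(1)) auto
    show "F q = p q + A q s * (g * p s) + (\<Sum>r\<in>S. (A q r + A q s * (g * A s r)) * F r)"
    proof -
      have "F q = p q + A q s * F s + (\<Sum>r\<in>S. A q r * F r)"
        using insert.prems(3)[of q] insert.hyps q by (simp add: algebra_simps)
      also have "\<dots> = p q + A q s * (g * p s) + (\<Sum>r\<in>S. (A q r + A q s * (g * A s r)) * F r)"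
        by (subst Fs) (simp add: algebra_simps sum.distrib sum_distrib_left)
      finally show ?thesis .
    qed
    fix r assume "r \<in> S"
    then show "rational_fps (A q r + A q s * (g * A s r)) \<and>
        fps_nth (A q r + A q s * (g * A s r)) 0 = 0"
      using q by (auto simp: A intro!: rational_fps_add rational_fps_mult rat_g A)
  qed
  moreover have "rational_fps (F s)"
    by (subst Fs) (use rat_S in \<open>auto intro!: rational_fps_add rational_fps_mult
        rational_fps_sum rat_g A insert.prems(1)\<close>)
  ultimately show ?case by simp
qed simp

text \<open>Compare coefficients in \<open>q * f = p\<close> beyond the degree of \<open>p\<close>.
  Summing up to \<open>Suc (degree q)\<close> adds only a zero term, but keeps the order of the
  recurrence positive when \<open>q\<close> is constant.\<close>

lemma rational_fps_imp_recurrence: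
  assumes "rational_fps f"
  shows "\<exists>d m c. \<forall>n\<ge>m. d \<le> n \<and> fps_nth f n = (\<Sum>i=1..Suc d. c i * fps_nth f (n - i))"
proof -
  obtain p q where q: "coeff q 0 = 1" and f: "fps_of_poly q * f = fps_of_poly p"
    using assms unfolding rational_fps_def by blast
  have "fps_nth f n = (\<Sum>i=1..Suc (degree q). - coeff q i * fps_nth f (n - i))"
    if n: "n \<ge> degree p + degree q + 2" for n
  proof -
    have "0 = fps_nth (fps_of_poly q * f) n"
      using n by (simp add: f coeff_eq_0)
    also have "\<dots> = (\<Sum>i=0..n. coeff q i * fps_nth f (n - i))"
      by (simp add: fps_mult_nth)
    also have "\<dots> = (\<Sum>i=0..Suc (degree q). coeff q i * fps_nth f (n - i))"
      using n by (intro sum.mono_neutral_right) (auto simp: coeff_eq_0)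
    also have "\<dots> = fps_nth f n + (\<Sum>i=1..Suc (degree q). coeff q i * fps_nth f (n - i))"
      by (subst sum.atLeast_Suc_atMost) (auto simp: q)
    finally show ?thesis by (simp add: sum_negf)
  qed
  then show ?thesis
    by (intro exI[of _ "degree q"] exI[of _ "degree p + degree q + 2"] exI[of _ "\<lambda>i. - coeff q i"]) auto
qed

section \<open>Counting words recognised by finitely many states\<close>

definition extensions :: "'c set \<Rightarrow> ('c list \<Rightarrow> bool) \<Rightarrow> 'c list \<Rightarrow> nat \<Rightarrow> 'c list set" where
  "extensions A P u k = {w. length w = k \<and> set w \<subseteq> A \<and> P (u @ w)}"

lemma finite_extensions: "finite A \<Longrightarrow> finite (extensions A P u k)"
  by (rule finite_subset[OF _ finite_lists_length_eq[of A k]]) (auto simp: extensions_def)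

lemma extensions_0: "extensions A P u 0 = (if P u then {[]} else {})"
  by (auto simp: extensions_def)

lemma card_extensions_Suc:
  assumes "finite A"
  shows "card (extensions A P u (Suc k)) = (\<Sum>c\<in>A. card (extensions A P (u @ [c]) k))"
proof -
  have "extensions A P u (Suc k) = (\<Union>c\<in>A. (#) c ` extensions A P (u @ [c]) k)"
    by (auto simp: extensions_def length_Suc_conv image_iff)
  also have "card \<dots> = (\<Sum>c\<in>A. card ((#) c ` extensions A P (u @ [c]) k))"
    using assms by (intro card_UN_disjoint) (auto simp: finite_extensions)
  finally show ?thesis by (simp add: card_image)
qed

text \<open>The transfer-matrix method: \<open>s u\<close> is the state of an automaton after
  reading \<open>u\<close>, and each state contributes one unknown series. Reading a letter costs a
  factor \<open>fps_X\<close>, so all coefficients of the linear system have constant term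
  0.\<close>

lemma rational_fps_extensions:
  assumes A: "finite A" and fin: "finite (s ` U)"
    and U: "\<And>u c. u \<in> U \<Longrightarrow> c \<in> A \<Longrightarrow> u @ [c] \<in> U"
    and s: "\<And>u v c. u \<in> U \<Longrightarrow> v \<in> U \<Longrightarrow> c \<in> A \<Longrightarrow> s u = s v \<Longrightarrow> s (u @ [c]) = s (v @ [c])"
    and P: "\<And>u v. u \<in> U \<Longrightarrow> v \<in> U \<Longrightarrow> s u = s v \<Longrightarrow> P u = P v"
    and u: "u \<in> U"
  shows "rational_fps (Abs_fps (\<lambda>k. int (card (extensions A P u k))))"
proof -
  define G where "G u = Abs_fps (\<lambda>k. int (card (extensions A P u k)))" for u
  define rep where "rep = inv_into U s"
  have rep: "rep q \<in> U" "s (rep q) = q" if "q \<in> s ` U" for q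
    using that unfolding rep_def by (auto intro: inv_into_into f_inv_into_f)
  \<comment> \<open>The number of accepted completions depends on the prefix only through its state,
    so the chosen representative of that state may replace the prefix.\<close>
  have "card (extensions A P u k) = card (extensions A P v k)"
    if "u \<in> U" "v \<in> U" "s u = s v" for u v k
    using that
  proof (induction k arbitrary: u v)
    case 0
    then show ?case using P[of u v] by (simp add: extensions_0)
  next
    case (Suc k)
    then show ?case
      unfolding card_extensions_Suc[OF A] by (intro sum.cong Suc.IH U s) auto
  qed
  then have G_rep: "G u = G (rep (s u))" if "u \<in> U" for u
    unfolding G_def using rep[of "s u"] that by (metis imageI)
  have G_rec: "G u = of_nat (if P u then 1 else 0) +
      (\<Sum>r\<in>s`U. (fps_X * of_nat (card {c\<in>A. s (u @ [c]) = r})) * G (rep r))"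
    if u: "u \<in> U" for u
  proof -
    have "G u = of_nat (if P u then 1 else 0) + fps_X * (\<Sum>c\<in>A. G (u @ [c]))"
    proof (rule fps_ext)
      fix k show "fps_nth (G u) k =
          fps_nth (of_nat (if P u then 1 else 0) + fps_X * (\<Sum>c\<in>A. G (u @ [c]))) k"
        by (cases k) (auto simp: G_def extensions_0 card_extensions_Suc[OF A] fps_sum_nth)
    qed
    also have "(\<Sum>c\<in>A. G (u @ [c])) = (\<Sum>c\<in>A. G (rep (s (u @ [c]))))"
      using u U by (intro sum.cong refl G_rep) auto
    \<comment> \<open>Letters are grouped by the state they lead to, which turns the sum over
      letters into a sum over unknowns.\<close>
    also have "\<dots> = (\<Sum>r\<in>s`U. \<Sum>c\<in>{c\<in>A. s (u @ [c]) = r}. G (rep (s (u @ [c]))))"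
      using u U by (intro sum.group[symmetric] A fin) auto
    also have "\<dots> = (\<Sum>r\<in>s`U. of_nat (card {c\<in>A. s (u @ [c]) = r}) * G (rep r))"
      by (intro sum.cong refl) simp
    finally show ?thesis by (simp add: sum_distrib_left mult.assoc)
  qed
  have "\<forall>q\<in>s`U. rational_fps (G (rep q))"
    by (rule rational_fps_linear_system[where F = "\<lambda>q. G (rep q)", OF fin _ _ G_rec[OF rep(1)]])
      (auto simp del: of_nat_mult simp: rational_fps_of_nat intro!: rational_fps_mult rational_fps_X)
  then show ?thesis using G_rep[OF u] u by (simp add: G_def)
qed

subsection \<open>Strongly connected words\<close>

text \<open>Vertices are integers because a step may lead below 0 or to a position that has not been
  read yet.\<close>

definition edges :: "int list \<Rightarrow> (int \<times> int) set" where
  "edges w = {(int i, int i + w ! i) | i. i < length w}"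

text \<open>The closure is not reflexive: already the case \<open>x = y\<close> yields a genuine
  closed walk through \<open>x\<close>, which later confines the steps to the positions of the
  word.\<close>

definition strong :: "int list \<Rightarrow> bool" where
  "strong w \<longleftrightarrow> (\<forall>x\<in>{0..<int (length w)}. \<forall>y\<in>{0..<int (length w)}. (x, y) \<in> (edges w)\<^sup>+)"

text \<open>Offsets are relative to the end of the word, so for fixed \<open>b\<close> there are
  only finitely many profiles. Nonnegative offsets stand for unread positions that earlier steps may
  already reach.\<close>

definition profile :: "int \<Rightarrow> int list \<Rightarrow> (int \<times> int) set" where
  "profile b w = {(x, y). x \<in> {-b..b} \<and> y \<in> {-b..b} \<and>
     (int (length w) + x, int (length w) + y) \<in> (edges w)\<^sup>+}"

text \<open>This one bit of information replaces the vertices that have left the window and are no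
  longer seen by \<open>profile\<close>.\<close>

definition anchored :: "int \<Rightarrow> int list \<Rightarrow> bool" where
  "anchored b w \<longleftrightarrow> (\<forall>x\<in>{0..<int (length w)}.
     (\<exists>y\<in>{int (length w) - b..<int (length w)}. (x, y) \<in> (edges w)\<^sup>*) \<and>
     (\<exists>y\<in>{int (length w) - b..<int (length w)}. (y, x) \<in> (edges w)\<^sup>*))"

lemma edges_snoc: "edges (w @ [c]) = insert (int (length w), int (length w) + c) (edges w)"
proof -
  have "edges v = (\<lambda>i. (int i, int i + v ! i)) ` {..<length v}" for v
    by (auto simp: edges_def)
  then show ?thesis by (simp add: lessThan_Suc nth_append)
qed

lemma edgesD:
  assumes "(x, y) \<in> edges w" "set w \<subseteq> {-b..b}"
  shows "0 \<le> x" "x < int (length w)" "x - b \<le> y" "y \<le> x + b"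
proof -
  obtain i where i: "i < length w" "x = int i" "y = int i + w ! i"
    using assms(1) by (auto simp: edges_def)
  moreover have "w ! i \<in> {-b..b}" using i(1) assms(2) nth_mem by blast
  ultimately show "0 \<le> x" "x < int (length w)" "x - b \<le> y" "y \<le> x + b" by simp_all
qed

lemma trancl_edgesD:
  assumes "(x, y) \<in> (edges w)\<^sup>+" "set w \<subseteq> {-b..b}"
  shows "x < int (length w)" "y < int (length w) + b"
proof -
  obtain x' y' where "(x, x') \<in> edges w" "(y', y) \<in> edges w"
    using tranclD[OF assms(1)] tranclD2[OF assms(1)] by blast
  from this[THEN edgesD(2)[OF _ assms(2)]] edgesD(4)[OF this(2) assms(2)]
  show "x < int (length w)" "y < int (length w) + b" by simp_all
qed

text \<open>The last edge of the path starts at a position already read and has length at most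
  \<open>b\<close>, so its source lies among the last \<open>b\<close> positions.\<close>

lemma rtrancl_edges_cross:
  assumes "(x, y) \<in> (edges w)\<^sup>*" "set w \<subseteq> {-b..b}" "x < int (length w)" "int (length w) \<le> y"
  shows "\<exists>z\<in>{int (length w) - b..<int (length w)}. (x, z) \<in> (edges w)\<^sup>*"
proof -
  from assms obtain z where "(x, z) \<in> (edges w)\<^sup>*" "(z, y) \<in> edges w"
    by (metis rtranclE linorder_not_le)
  with edgesD[OF this(2) assms(2)] assms(4) show ?thesis by (intro bexI[of _ z]) auto
qed

lemma trancl_edges_profile_cong:
  assumes "profile b u = profile b v" "set u \<subseteq> {-b..b}" "set v \<subseteq> {-b..b}"
    and "-b \<le> x" "x \<le> b + 1" "-b \<le> y" "y \<le> b + 1"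
  shows "(int (length u) + x, int (length u) + y) \<in> (edges u)\<^sup>+ \<longleftrightarrow>
         (int (length v) + x, int (length v) + y) \<in> (edges v)\<^sup>+"
proof (cases "x \<le> b \<and> y \<le> b")
  case True
  then show ?thesis using assms(4-) arg_cong[OF assms(1), of "\<lambda>K. (x, y) \<in> K"]
    by (simp add: profile_def)
next
  case False
  then show ?thesis
    using trancl_edgesD[OF _ assms(2)] trancl_edgesD[OF _ assms(3)] assms(4-)
    by (smt (verit))
qed

lemma rtrancl_edges_profile_cong:
  assumes "profile b u = profile b v" "set u \<subseteq> {-b..b}" "set v \<subseteq> {-b..b}"
    and "-b \<le> x" "x \<le> b + 1" "-b \<le> y" "y \<le> b + 1"
  shows "(int (length u) + x, int (length u) + y) \<in> (edges u)\<^sup>* \<longleftrightarrow>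
         (int (length v) + x, int (length v) + y) \<in> (edges v)\<^sup>*"
  using trancl_edges_profile_cong[OF assms] by (simp add: rtrancl_eq_or_trancl)

text \<open>A path either avoids the new edge or splits at it into old paths, and both ends of the
  new edge lie in the window.\<close>

lemma trancl_edges_snoc_cong:
  assumes "profile b u = profile b v" "set u \<subseteq> {-b..b}" "set v \<subseteq> {-b..b}" "c \<in> {-b..b}"
    and "-b \<le> x" "x \<le> b + 1" "-b \<le> y" "y \<le> b + 1"
  shows "(int (length u) + x, int (length u) + y) \<in> (edges (u @ [c]))\<^sup>+ \<longleftrightarrow>
         (int (length v) + x, int (length v) + y) \<in> (edges (v @ [c]))\<^sup>+"
proof -
  \<comment> \<open>The summand \<open>0\<close> presents the source of the new edge as an offset,
    in the form that the congruence lemmas rewrite.\<close>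
  have snoc: "(p, q) \<in> (edges (w @ [c]))\<^sup>+ \<longleftrightarrow> (p, q) \<in> (edges w)\<^sup>+ \<or>
      (p, int (length w) + 0) \<in> (edges w)\<^sup>* \<and> (int (length w) + c, q) \<in> (edges w)\<^sup>*" for w p q
    by (simp add: edges_snoc trancl_insert)
  have b: "-b \<le> 0" "0 \<le> b + 1" "-b \<le> c" "c \<le> b + 1"
    using assms(4) by simp_all
  show ?thesis
    unfolding snoc trancl_edges_profile_cong[OF assms(1-3,5-8)]
      rtrancl_edges_profile_cong[OF assms(1-3,5,6) b(1,2)]
      rtrancl_edges_profile_cong[OF assms(1-3) b(3,4) assms(7,8)] ..
qed

lemma rtrancl_edges_snoc_cong:
  assumes "profile b u = profile b v" "set u \<subseteq> {-b..b}" "set v \<subseteq> {-b..b}" "c \<in> {-b..b}"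
    and "-b \<le> x" "x \<le> b + 1" "-b \<le> y" "y \<le> b + 1"
  shows "(int (length u) + x, int (length u) + y) \<in> (edges (u @ [c]))\<^sup>* \<longleftrightarrow>
         (int (length v) + x, int (length v) + y) \<in> (edges (v @ [c]))\<^sup>*"
  using trancl_edges_snoc_cong[OF assms] by (simp add: rtrancl_eq_or_trancl)

lemma profile_snoc_cong:
  assumes "profile b u = profile b v" "set u \<subseteq> {-b..b}" "set v \<subseteq> {-b..b}" "c \<in> {-b..b}"
  shows "profile b (u @ [c]) = profile b (v @ [c])"
proof -
  \<comment> \<open>Offset \<open>x\<close> from the new end of the word is offset
    \<open>x + 1\<close> from the old one.\<close>
  have "(x, y) \<in> profile b (u @ [c]) \<longleftrightarrow> (x, y) \<in> profile b (v @ [c])" for x y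
    using trancl_edges_snoc_cong[OF assms, of "x + 1" "y + 1"]
    by (auto simp: profile_def algebra_simps)
  then show ?thesis by auto
qed

text \<open>Appending a letter moves the window by one, so only the vertex that leaves the window
  has to be examined.\<close>

lemma anchored_snoc:
  assumes w: "set w \<subseteq> {-b..b}" and c: "c \<in> {-b..b}" and len: "b \<le> int (length w)" and b: "0 < b"
  shows "anchored b (w @ [c]) \<longleftrightarrow> anchored b w \<and>
    (\<exists>y\<in>{1-b..0}. (int (length w) + (-b), int (length w) + y) \<in> (edges (w @ [c]))\<^sup>*) \<and>
    (\<exists>y\<in>{1-b..0}. (int (length w) + y, int (length w) + (-b)) \<in> (edges (w @ [c]))\<^sup>*)"
    (is "?L \<longleftrightarrow> _ \<and> ?out \<and> ?in")
proof -
  define m where "m = int (length w)"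
  let ?R = "edges w" and ?R' = "edges (w @ [c])"
  have mono: "?R\<^sup>* \<subseteq> ?R'\<^sup>*"
    by (intro rtrancl_mono) (auto simp: edges_snoc)
  have R': "(x, y) \<in> ?R'\<^sup>* \<longleftrightarrow> (x, y) \<in> ?R\<^sup>* \<or> (x, m) \<in> ?R\<^sup>* \<and> (m + c, y) \<in> ?R\<^sup>*" for x y
    by (auto simp: edges_snoc rtrancl_insert m_def)
  have cross: "\<exists>z\<in>{m - b..<m}. (x, z) \<in> ?R\<^sup>*" if "(x, y) \<in> ?R\<^sup>*" "x < m" "m - b \<le> y" for x y
    using rtrancl_edges_cross[OF that(1) w] that unfolding m_def by fastforce
  have dom: "x < m \<or> x = y" if "(x, y) \<in> ?R\<^sup>*" for x y
    using that trancl_edgesD(1)[OF _ w] by (auto simp: rtrancl_eq_or_trancl m_def)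
  show ?thesis
  proof (intro iffI conjI)
    assume L: ?L
    have out': "\<exists>y\<in>{m+1-b..<m+1}. (x, y) \<in> ?R'\<^sup>*" and in': "\<exists>y\<in>{m+1-b..<m+1}. (y, x) \<in> ?R'\<^sup>*"
      if "0 \<le> x" "x < m + 1" for x
      using L that by (auto simp: anchored_def m_def algebra_simps)
    show "anchored b w"
      unfolding anchored_def m_def[symmetric]
    proof (intro ballI conjI)
      fix x assume x: "x \<in> {0..<m}"
      then have x': "0 \<le> x" "x < m" "x < m + 1" by auto
      obtain y where "y \<in> {m+1-b..<m+1}" "(x, y) \<in> ?R'\<^sup>*"
        using out'[OF x'(1,3)] by blast
      \<comment> \<open>If the path uses the new edge, its part before that edge is an old path to
        \<open>m\<close>. Either way an old path from \<open>x\<close> reaches some vertex from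
        \<open>m - b\<close> on, so \<open>cross\<close> applies.\<close>
      then have "(x, y) \<in> ?R\<^sup>* \<or> (x, m) \<in> ?R\<^sup>*" "m - b \<le> y" "m - b \<le> m"
        using b by (simp_all add: R') blast
      then show "\<exists>y\<in>{m - b..<m}. (x, y) \<in> ?R\<^sup>*"
        using cross x'(2) by blast
      obtain y where y: "y \<in> {m+1-b..<m+1}" "(y, x) \<in> ?R'\<^sup>*"
        using in'[OF x'(1,3)] by blast
      then have "(y, x) \<in> ?R\<^sup>* \<or> (m + c, x) \<in> ?R\<^sup>*" by (simp add: R') blast
      then show "\<exists>y\<in>{m - b..<m}. (y, x) \<in> ?R\<^sup>*"
      proof
        assume "(y, x) \<in> ?R\<^sup>*"
        then show ?thesis using dom[of y x] x y(1) by (intro bexI[of _ y]) auto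
      next
        assume "(m + c, x) \<in> ?R\<^sup>*"
        \<comment> \<open>The target of the new edge is itself the anchor: an old path leads from it
          to \<open>x < m\<close>, so it is below \<open>m\<close>, and \<open>c\<close> is at least
          \<open>-b\<close>.\<close>
        then show ?thesis using dom[of "m + c" x] x c by (intro bexI[of _ "m + c"]) auto
      qed
    qed
    have m: "0 \<le> m - b" "m - b < m + 1"
      using len b by (simp_all add: m_def)
    obtain y where "y \<in> {m+1-b..<m+1}" "(m - b, y) \<in> ?R'\<^sup>*"
      using out'[OF m] by blast
    then show ?out
      unfolding m_def[symmetric] by (intro bexI[of _ "y - m"]) simp_all
    obtain y where "y \<in> {m+1-b..<m+1}" "(y, m - b) \<in> ?R'\<^sup>*"
      using in'[OF m] by blast
    then show ?in
      unfolding m_def[symmetric] by (intro bexI[of _ "y - m"]) simp_all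
  next
    assume H: "anchored b w \<and> ?out \<and> ?in"
    obtain y z where "y \<in> {1-b..0}" "(m + (-b), m + y) \<in> ?R'\<^sup>*"
        "z \<in> {1-b..0}" "(m + z, m + (-b)) \<in> ?R'\<^sup>*"
      using H unfolding m_def[symmetric] by blast
    \<comment> \<open>Only \<open>m - b\<close> leaves the window. A path anchored at it is
      prolonged to \<open>p\<close>, or preceded by the path from \<open>q\<close>, inside the new
      window.\<close>
    then obtain p q where p: "p \<in> {m+1-b..<m+1}" "(m - b, p) \<in> ?R'\<^sup>*"
        and q: "q \<in> {m+1-b..<m+1}" "(q, m - b) \<in> ?R'\<^sup>*"
      using that[of "m + y" "m + z"] by auto
    have "(\<exists>y\<in>{m+1-b..<m+1}. (x, y) \<in> ?R'\<^sup>*) \<and> (\<exists>y\<in>{m+1-b..<m+1}. (y, x) \<in> ?R'\<^sup>*)"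
      if x: "x \<in> {0..<m+1}" for x
    proof (cases "x = m")
      case True
      then show ?thesis using b by (auto intro!: bexI[of _ m])
    next
      case False
      then have "x \<in> {0..<m}" using x by auto
      with H obtain y z where y: "y \<in> {m - b..<m}" "(x, y) \<in> ?R'\<^sup>*"
        and z: "z \<in> {m - b..<m}" "(z, x) \<in> ?R'\<^sup>*"
        using mono unfolding anchored_def m_def[symmetric] by blast
      have "\<exists>y\<in>{m+1-b..<m+1}. (x, y) \<in> ?R'\<^sup>*"
      proof (cases "y = m - b")
        case True
        then show ?thesis using rtrancl_trans[OF y(2)] p by blast
      next
        case False
        then have "y \<in> {m+1-b..<m+1}" using y(1) by simp
        then show ?thesis using y(2) by blast
      qed
      moreover have "\<exists>z\<in>{m+1-b..<m+1}. (z, x) \<in> ?R'\<^sup>*"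
      proof (cases "z = m - b")
        case True
        then show ?thesis using rtrancl_trans[OF q(2)] q(1) z(2) by blast
      next
        case False
        then have "z \<in> {m+1-b..<m+1}" using z(1) by simp
        then show ?thesis using z(2) by blast
      qed
      ultimately show ?thesis by blast
    qed
    then show ?L unfolding anchored_def by (simp add: m_def algebra_simps)
  qed
qed

lemma anchored_snoc_cong:
  assumes "profile b u = profile b v" "anchored b u = anchored b v"
    and "set u \<subseteq> {-b..b}" "set v \<subseteq> {-b..b}" "c \<in> {-b..b}"
    and "b \<le> int (length u)" "b \<le> int (length v)" "0 < b"
  shows "anchored b (u @ [c]) = anchored b (v @ [c])"
proof -
  have E: "(int (length u) + x, int (length u) + y) \<in> (edges (u @ [c]))\<^sup>* \<longleftrightarrow>
        (int (length v) + x, int (length v) + y) \<in> (edges (v @ [c]))\<^sup>*"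
    if "x \<in> {-b..0}" "y \<in> {-b..0}" for x y
    using that assms(8) by (intro rtrancl_edges_snoc_cong[OF assms(1,3-5)]) auto
  show ?thesis
    unfolding anchored_snoc[OF assms(3,5,6,8)] anchored_snoc[OF assms(4,5,7,8)] assms(2)
    using assms(8) by (intro arg_cong2[where f = "(\<and>)"] bex_cong refl E) simp_all
qed

text \<open>Paths are routed through the last \<open>b\<close> vertices: anchoring supplies the two
  outer pieces and the profile a nonempty middle piece. The length bound keeps the window inside the
  word.\<close>

lemma strong_iff_anchored:
  assumes "b \<le> int (length w)" "0 < b"
  shows "strong w \<longleftrightarrow> anchored b w \<and> {-b..<0} \<times> {-b..<0} \<subseteq> profile b w"
proof -
  define m where "m = int (length w)"
  show ?thesis
  proof (intro iffI conjI)
    assume s: "strong w"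
    then have *: "(x, y) \<in> (edges w)\<^sup>+" if "x \<in> {0..<m}" "y \<in> {0..<m}" for x y
      using that by (simp add: strong_def m_def)
    show "anchored b w"
      unfolding anchored_def m_def[symmetric]
      using assms * by (auto intro!: bexI[of _ "m - 1"] intro: trancl_into_rtrancl simp: m_def[symmetric])
    show "{-b..<0} \<times> {-b..<0} \<subseteq> profile b w"
      using assms * by (auto simp: profile_def m_def[symmetric])
  next
    assume H: "anchored b w \<and> {-b..<0} \<times> {-b..<0} \<subseteq> profile b w"
    have "(x, y) \<in> (edges w)\<^sup>+" if "x \<in> {0..<m}" "y \<in> {0..<m}" for x y
    proof -
      from H that obtain x' y' where x': "x' \<in> {m - b..<m}" "(x, x') \<in> (edges w)\<^sup>*"
        and y': "y' \<in> {m - b..<m}" "(y', y) \<in> (edges w)\<^sup>*"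
        unfolding anchored_def m_def[symmetric] by blast
      then have "(x' - m, y' - m) \<in> profile b w" using H by auto
      then have "(x', y') \<in> (edges w)\<^sup>+" by (simp add: profile_def m_def)
      from rtrancl_trancl_trancl[OF x'(2) trancl_rtrancl_trancl[OF this y'(2)]] show ?thesis .
    qed
    then show "strong w" by (simp add: strong_def m_def)
  qed
qed

subsection \<open>Walks\<close>

definition jump :: "int list \<Rightarrow> int \<Rightarrow> int" where
  "jump w x = x + w ! nat x"

definition walk :: "int list \<Rightarrow> nat list" where
  "walk w = map (\<lambda>k. nat ((jump w ^^ k) 0)) [0..<length w]"

lemma edges_iff: "(x, y) \<in> edges w \<longleftrightarrow> x \<in> {0..<int (length w)} \<and> y = jump w x"
proof
  assume "x \<in> {0..<int (length w)} \<and> y = jump w x"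
  then show "(x, y) \<in> edges w"
    by (auto simp: edges_def jump_def intro!: exI[of _ "nat x"])
qed (auto simp: edges_def jump_def)

lemma trancl_edges_imp_orbit: "(x, y) \<in> (edges w)\<^sup>+ \<Longrightarrow> y \<in> orbit (jump w) x"
proof (induction rule: trancl_induct)
  case (base y)
  then show ?case by (simp add: edges_iff orbit.base)
next
  case (step y z)
  from step.hyps(2) have "z = jump w y" by (simp add: edges_iff)
  with orbit.step[OF step.IH] show ?case by simp
qed

lemma orbit_imp_trancl_edges:
  assumes "y \<in> orbit (jump w) x" "x \<in> {0..<int (length w)}"
    and "\<And>z. z \<in> {0..<int (length w)} \<Longrightarrow> jump w z \<in> {0..<int (length w)}"
  shows "(x, y) \<in> (edges w)\<^sup>+"
proof -
  have "y \<in> {0..<int (length w)} \<and> (x, y) \<in> (edges w)\<^sup>+"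
    using assms(1)
  proof induction
    case base
    have "(x, jump w x) \<in> edges w" using assms(2) unfolding edges_iff by blast
    then show ?case using assms(2,3) by blast
  next
    case (step y)
    then have "(y, jump w y) \<in> edges w" unfolding edges_iff by blast
    with step show ?case using assms(3) trancl_into_trancl by metis
  qed
  then show ?thesis by blast
qed

text \<open>The closed walk through \<open>x\<close> begins with the edge to
  \<open>jump w x\<close>. That vertex is \<open>x\<close> itself or has an outgoing edge, so it is
  a position of the word.\<close>

lemma strong_jump_closed:
  assumes "strong w" "x \<in> {0..<int (length w)}"
  shows "jump w x \<in> {0..<int (length w)}"
proof -
  have "(x, x) \<in> (edges w)\<^sup>+" using assms by (simp add: strong_def)
  then obtain y where "(x, y) \<in> edges w" "(y, x) \<in> (edges w)\<^sup>*" by (blast dest: tranclD)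
  then show ?thesis
    using assms(2) by (auto simp: edges_iff elim: converse_rtranclE)
qed

lemma strong_imp_cycle:
  assumes "strong w" "w \<noteq> []"
  shows "bij_betw (\<lambda>k. (jump w ^^ k) 0) {0..<length w} {0..<int (length w)}"
    and "(jump w ^^ length w) 0 = 0"
proof -
  let ?n = "length w" and ?f = "jump w"
  have 0: "0 \<in> {0..<int ?n}" using assms(2) by simp
  have orbit_iff: "y \<in> orbit ?f 0" if "y \<in> {0..<int ?n}" for y
    using assms(1) 0 that by (auto simp: strong_def intro: trancl_edges_imp_orbit)
  moreover have "y \<in> {0..<int ?n}" if "y \<in> orbit ?f 0" for y
    using that by induction (use strong_jump_closed[OF assms(1)] 0 in blast)+
  ultimately have orbit: "orbit ?f 0 = {0..<int ?n}" by blast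
  \<comment> \<open>The first return time to 0; before it the iterates are distinct and exhaust the
    orbit, so counting the orbit gives \<open>p = length w\<close>.\<close>
  define p where "p = funpow_dist1 ?f 0 0"
  have self: "0 \<in> orbit ?f 0" using orbit 0 by simp
  have inj: "inj_on (\<lambda>k. (?f ^^ k) 0) {0..<p}"
    unfolding p_def by (rule inj_on_funpow_dist1[OF self])
  have img: "(\<lambda>k. (?f ^^ k) 0) ` {0..<p} = {0..<int ?n}"
    unfolding p_def orbit_conv_funpow_dist1[OF self, symmetric] by (rule orbit)
  have "p = ?n"
    using card_image[OF inj] unfolding img by simp
  with inj img show "bij_betw (\<lambda>k. (?f ^^ k) 0) {0..<?n} {0..<int ?n}"
    by (simp add: bij_betw_def)
  show "(?f ^^ ?n) 0 = 0"
    using funpow_dist1_prop[OF self] unfolding p_def[symmetric] \<open>p = ?n\<close> .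
qed

lemma length_walk [simp]: "length (walk w) = length w"
  by (simp add: walk_def)

lemma jump_funpow_Suc_mod:
  assumes "strong w" "k < length w"
  shows "(jump w ^^ (Suc k mod length w)) 0 = jump w ((jump w ^^ k) 0)"
proof (cases "Suc k = length w")
  case True
  then show ?thesis
    using strong_imp_cycle(2)[OF assms(1)] assms(2) by (metis funpow.simps(2) funpow_0 list.size(3) mod_self not_less_zero o_apply)
qed (use assms(2) in simp)

lemma int_walk_nth:
  assumes "strong w" "k < length w"
  shows "int (walk w ! k) = (jump w ^^ k) 0"
proof -
  have "w \<noteq> []" using assms(2) by auto
  then have "(jump w ^^ k) 0 \<in> {0..<int (length w)}"
    using bij_betwE[OF strong_imp_cycle(1)[OF assms(1)]] assms(2) by auto
  then show ?thesis using assms(2) by (simp add: walk_def)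
qed

lemma walk_distinct_set:
  assumes "strong w"
  shows "distinct (walk w)" "set (walk w) = {0..<length w}"
proof -
  have bij: "bij_betw (\<lambda>k. walk w ! k) {0..<length w} {0..<length w}"
  proof (cases "w = []")
    case False
    have "bij_betw (nat \<circ> (\<lambda>k. (jump w ^^ k) 0)) {0..<length w} {0..<length w}"
      by (rule bij_betw_trans[OF strong_imp_cycle(1)[OF assms False]])
        (rule bij_betwI[of _ _ _ int], auto)
    then show ?thesis by (rule bij_betw_cong[THEN iffD1, rotated]) (simp add: walk_def)
  qed (simp add: bij_betw_def)
  have walk: "walk w = map (\<lambda>k. walk w ! k) [0..<length w]"
    using map_nth[of "walk w"] by simp
  show "distinct (walk w)"
    by (subst walk) (use bij in \<open>simp add: distinct_map bij_betw_def\<close>)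
  show "set (walk w) = {0..<length w}"
    by (subst walk) (use bij in \<open>simp add: bij_betw_def\<close>)
qed

lemma walk_Suc_nth:
  assumes "strong w" "k < length w"
  shows "int (walk w ! (Suc k mod length w)) = int (walk w ! k) + w ! (walk w ! k)"
proof -
  have "Suc k mod length w < length w" using assms(2) by (intro mod_less_divisor) linarith
  then show ?thesis
    using int_walk_nth[OF assms] int_walk_nth[OF assms(1), of "Suc k mod length w"]
      jump_funpow_Suc_mod[OF assms]
    by (metis nat_int jump_def)
qed

lemma walk_inj:
  assumes "strong w" "strong w'" "walk w = walk w'"
  shows "w = w'"
proof (rule nth_equalityI)
  show len: "length w = length w'" using assms(3) length_walk by metis
  fix i assume "i < length w"
  then obtain k where "k < length w" "walk w ! k = i"
    using walk_distinct_set(2)[OF assms(1)] by (metis in_set_conv_nth length_walk atLeastLessThan_iff le0)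
  then show "w ! i = w' ! i"
    using walk_Suc_nth[OF assms(1), of k] walk_Suc_nth[OF assms(2), of k] assms(3) len by simp
qed

text \<open>The word is recovered from the circle: its letter at \<open>v\<close> is the cyclic
  successor of \<open>v\<close> minus \<open>v\<close>.\<close>

lemma walk_surj:
  assumes "distinct xs" "set xs = {0..<n}" "n > 0" "xs ! 0 = 0"
  shows "\<exists>w. length w = n \<and> strong w \<and> walk w = xs"
proof -
  have len: "length xs = n" using distinct_card[OF assms(1)] assms(2) by simp
  define pos where "pos v = (THE i. i < n \<and> xs ! i = v)" for v
  have pos: "pos (xs ! i) = i" if "i < n" for i
    unfolding pos_def using that assms(1) len by (auto simp: nth_eq_iff_index_eq)
  define w where "w = map (\<lambda>v. int (xs ! (Suc (pos v) mod n)) - int v) [0..<n]"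
  have lw: "length w = n" by (simp add: w_def)
  have xs_lt: "xs ! i < n" if "i < n" for i
    using that assms(2) len nth_mem[of i xs] by auto
  have jump: "jump w (int (xs ! (i mod n))) = int (xs ! (Suc i mod n))" for i
    using assms(3) xs_lt[of "i mod n"] by (simp add: jump_def w_def pos mod_Suc_eq)
  have funpow: "(jump w ^^ k) (int (xs ! (i mod n))) = int (xs ! ((i + k) mod n))" for i k
    by (induction k) (simp_all add: jump)
  have ex: "\<exists>i<n. x = int (xs ! i)" if x: "x \<in> {0..<int n}" for x
  proof -
    have "nat x \<in> set xs" using x assms(2) by auto
    then obtain i where "i < n" "xs ! i = nat x" using len by (metis in_set_conv_nth)
    then show ?thesis using x by auto
  qed
  have "strong w"
    unfolding strong_def lw
  proof (intro ballI)
    fix x y assume x: "x \<in> {0..<int n}" and y: "y \<in> {0..<int n}"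
    obtain i j where i: "i < n" "x = int (xs ! i)" and j: "j < n" "y = int (xs ! j)"
      using ex[OF x] ex[OF y] by blast
    \<comment> \<open>From place \<open>i\<close>, \<open>n - i\<close> steps return to place 0 and
      \<open>j\<close> more reach place \<open>j\<close>. The number of steps is positive even for
      \<open>i = j\<close>, as membership in an orbit demands.\<close>
    have "(jump w ^^ (n - i + j)) x = int (xs ! ((i + (n - i + j)) mod n))"
      using funpow[of "n - i + j" i] i by simp
    also have "\<dots> = y" using i j by simp
    finally have "y \<in> orbit (jump w) x"
      using i(1) unfolding orbit_altdef by (intro CollectI exI[of _ "n - i + j"]) auto
    then show "(x, y) \<in> (edges w)\<^sup>+"
    proof (rule orbit_imp_trancl_edges)
      show "x \<in> {0..<int (length w)}" using x lw by simp
      fix z assume "z \<in> {0..<int (length w)}"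
      then obtain i where "i < n" "z = int (xs ! i)" using ex lw by auto
      then show "jump w z \<in> {0..<int (length w)}"
        using jump[of i] xs_lt[of "Suc i mod n"] lw by simp
    qed
  qed
  moreover have "walk w = xs"
    using funpow[of _ 0] assms(3,4) by (intro nth_equalityI) (auto simp: walk_def lw len)
  ultimately show ?thesis using lw by blast
qed

subsection \<open>Necklaces with a base point\<close>

lemma arrangementsD:
  assumes "xs \<in> arrangements a b n"
  shows "distinct xs" "set xs = {0..<n}" "length xs = n"
    and "\<And>i. i < n \<Longrightarrow> \<bar>int (xs ! i) - int (xs ! (Suc i mod n))\<bar> \<in> {int a, int b}"
proof -
  show xs: "distinct xs" "set xs = {0..<n}"
    using assms by (simp_all add: arrangements_def)
  then show "length xs = n" using distinct_card[of xs] by simp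
  fix i assume "i < n"
  then show "\<bar>int (xs ! i) - int (xs ! (Suc i mod n))\<bar> \<in> {int a, int b}"
    using assms unfolding arrangements_def by simp
qed

lemma arrangements_rotate:
  assumes "xs \<in> arrangements a b n"
  shows "rotate k xs \<in> arrangements a b n"
proof -
  note xs = arrangementsD[OF assms]
  have "\<bar>int (rotate k xs ! i) - int (rotate k xs ! (Suc i mod n))\<bar> \<in> {int a, int b}"
    if "i < n" for i
  proof -
    have "Suc i mod n < n" "(k + i) mod n < n" using that by (auto intro: mod_less_divisor)
    moreover have "(k + Suc i mod n) mod n = Suc ((k + i) mod n) mod n"
      by (simp add: mod_simps)
    ultimately show ?thesis
      using xs(4)[of "(k + i) mod n"] that by (simp add: nth_rotate xs(3))
  qed
  then show ?thesis using xs(1,2) by (simp add: arrangements_def)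
qed

lemma arrangements_rev:
  assumes "xs \<in> arrangements a b n"
  shows "rev xs \<in> arrangements a b n"
proof -
  note xs = arrangementsD[OF assms]
  have "\<bar>int (rev xs ! i) - int (rev xs ! (Suc i mod n))\<bar> \<in> {int a, int b}"
    if i: "i < n" for i
  proof -
    \<comment> \<open>The place in \<open>xs\<close> of the later of the two entries compared in
      \<open>rev xs\<close>; its cyclic successor in \<open>xs\<close> is the earlier one.\<close>
    define j where "j = n - Suc (Suc i mod n)"
    have lt: "Suc i mod n < n" using i by (intro mod_less_divisor) linarith
    then have "j < n" by (simp add: j_def)
    have "Suc j mod n = n - Suc i"
      using i by (cases "Suc i = n") (auto simp: j_def Suc_diff_Suc)
    then show ?thesis
      using xs(4)[OF \<open>j < n\<close>] i lt
      by (simp add: rev_nth xs(3) j_def abs_minus_commute)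
  qed
  then show ?thesis using xs(1,2) by (simp add: arrangements_def)
qed

text \<open>Starting at 0 fixes the rotation, and continuing with \<open>a\<close> fixes the
  orientation; for \<open>3 \<le> n\<close> this selects one representative per necklace.\<close>

definition based_arrangements :: "nat \<Rightarrow> nat \<Rightarrow> nat \<Rightarrow> nat list set" where
  "based_arrangements a b n = {xs \<in> arrangements a b n. xs ! 0 = 0 \<and> xs ! 1 = a}"

lemma based_arrangement_last:
  assumes xs: "xs \<in> arrangements a b n" and n: "3 \<le> n" and "xs ! 0 = 0"
  shows "{xs ! 1, xs ! (n - 1)} = {a, b}" "xs ! 1 \<noteq> xs ! (n - 1)"
proof -
  note xs' = arrangementsD[OF xs]
  show ne: "xs ! 1 \<noteq> xs ! (n - 1)"
    using xs'(1,3) n by (simp add: nth_eq_iff_index_eq)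
  have "xs ! 1 \<in> {a, b}" "xs ! (n - 1) \<in> {a, b}"
    using xs'(4)[of 0] xs'(4)[of "n - 1"] n assms(3) by auto
  with ne show "{xs ! 1, xs ! (n - 1)} = {a, b}" by auto
qed

text \<open>A rotation that keeps 0 in front is trivial. A reflection that keeps 0 in front
  exchanges its two neighbours, which are distinct, so the second entry could not remain
  \<open>a\<close>.\<close>

lemma based_arrangements_unique:
  assumes xs: "xs \<in> based_arrangements a b n" and ys: "ys \<in> based_arrangements a b n"
    and n: "3 \<le> n" and "(xs, ys) \<in> same_necklace a b n"
  shows "xs = ys"
proof -
  have arr: "xs \<in> arrangements a b n" and xs0: "xs ! 0 = 0" "xs ! 1 = a"
    and ys0: "ys ! 0 = 0" "ys ! 1 = a"
    using xs ys by (auto simp: based_arrangements_def)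
  note xs' = arrangementsD[OF arr]
  obtain k where "ys = rotate k xs \<or> ys = rotate k (rev xs)"
    using assms(4) by (auto simp: same_necklace_def)
  then show ?thesis
  proof
    assume k: "ys = rotate k xs"
    then have "xs ! (k mod n) = xs ! 0"
      using ys0(1) xs0(1) n by (simp add: nth_rotate xs'(3))
    moreover have "k mod n < n" "0 < n" using n by auto
    ultimately have "k mod n = 0" using xs'(1,3) nth_eq_iff_index_eq by metis
    then show ?thesis using k rotate_conv_mod[of k xs] xs'(3) by simp
  next
    assume k: "ys = rotate k (rev xs)"
    have kn: "k mod n < n" using n by simp
    then have "xs ! (n - Suc (k mod n)) = xs ! 0"
      using k ys0(1) xs0(1) n by (simp add: nth_rotate rev_nth xs'(3))
    moreover have "n - Suc (k mod n) < n" "0 < n" using n by auto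
    ultimately have "n - Suc (k mod n) = 0" using xs'(1,3) nth_eq_iff_index_eq by metis
    then have "Suc k mod n = 0" using kn by (simp add: mod_Suc)
    moreover have "rotate k (rev xs) ! 1 = rev xs ! (Suc k mod n)"
      using n by (simp add: nth_rotate xs'(3))
    ultimately have "ys ! 1 = xs ! (n - 1)"
      using k n by (simp add: rev_nth xs'(3))
    then show ?thesis
      using based_arrangement_last(2)[OF arr n xs0(1)] xs0(2) ys0(2) by simp
  qed
qed

lemma based_arrangements_exists:
  assumes xs: "xs \<in> arrangements a b n" and n: "3 \<le> n"
  shows "\<exists>ys\<in>based_arrangements a b n. (xs, ys) \<in> same_necklace a b n"
proof -
  note xs' = arrangementsD[OF xs]
  have "0 \<in> set xs" using xs'(2) n by simp
  then obtain k where k: "k < n" "xs ! k = 0" using xs'(3) by (auto simp: in_set_conv_nth)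
  define ys where "ys = rotate k xs"
  have ys: "ys \<in> arrangements a b n" unfolding ys_def by (rule arrangements_rotate[OF xs])
  have ys0: "ys ! 0 = 0"
    using k n by (simp add: ys_def nth_rotate xs'(3))
  have rel: "(xs, ys) \<in> same_necklace a b n"
    using xs ys by (auto simp: same_necklace_def ys_def)
  show ?thesis
  proof (cases "ys ! 1 = a")
    case True
    then show ?thesis using ys ys0 rel by (auto simp: based_arrangements_def)
  next
    case False
    \<comment> \<open>Reversal sends the leading 0 to the end, and rotating by \<open>n - 1\<close>
      brings it back to the front with its neighbours exchanged.\<close>
    define zs where "zs = rotate (n - 1) (rev ys)"
    have zs: "zs \<in> arrangements a b n"
      unfolding zs_def by (intro arrangements_rotate arrangements_rev ys)
    have ly: "length ys = n" using arrangementsD(3)[OF ys] .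
    have "zs ! 0 = 0"
      using n ys0 by (simp add: zs_def nth_rotate ly rev_nth)
    moreover have "zs ! 1 = ys ! (n - 1)"
      using n by (simp add: zs_def nth_rotate ly rev_nth)
    then have "zs ! 1 = a"
      using based_arrangement_last(1)[OF ys n ys0] False by (auto simp: doubleton_eq_iff)
    moreover have "(ys, zs) \<in> same_necklace a b n"
      using ys zs by (auto simp: same_necklace_def zs_def)
    then have "(xs, zs) \<in> same_necklace a b n"
      using rel equiv_same_necklace[of a b n] by (meson equivE transD)
    ultimately show ?thesis using zs by (auto simp: based_arrangements_def)
  qed
qed

lemma num_necklaces_eq_card_based:
  assumes "3 \<le> n"
  shows "num_necklaces a b n = card (based_arrangements a b n)"
proof -
  let ?cls = "\<lambda>xs. same_necklace a b n `` {xs}"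
  have sub: "based_arrangements a b n \<subseteq> arrangements a b n"
    by (auto simp: based_arrangements_def)
  have "inj_on ?cls (based_arrangements a b n)"
  proof (rule inj_onI)
    fix xs ys assume xy: "xs \<in> based_arrangements a b n" "ys \<in> based_arrangements a b n" "?cls xs = ?cls ys"
    then have "(xs, ys) \<in> same_necklace a b n"
      using sub by (intro eq_equiv_class[OF xy(3) equiv_same_necklace]) auto
    then show "xs = ys" using based_arrangements_unique xy(1,2) assms by blast
  qed
  moreover have "?cls ` based_arrangements a b n = necklaces a b n"
  proof (intro subset_antisym subsetI)
    fix C assume "C \<in> necklaces a b n"
    then obtain xs where "xs \<in> arrangements a b n" "C = ?cls xs"
      by (auto simp: necklaces_def elim: quotientE)
    moreover from this obtain ys where "ys \<in> based_arrangements a b n" "(xs, ys) \<in> same_necklace a b n"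
      using based_arrangements_exists[OF _ assms] by blast
    ultimately show "C \<in> ?cls ` based_arrangements a b n"
      using equiv_class_eq[OF equiv_same_necklace] by (metis imageI)
  qed (use sub in \<open>auto simp: necklaces_def intro!: quotientI\<close>)
  ultimately show ?thesis
    unfolding num_necklaces_def by (metis card_image)
qed

section \<open>From necklaces to strongly connected words\<close>

definition letters :: "nat \<Rightarrow> nat \<Rightarrow> int set" where
  "letters a b = {int a, int b, - int a, - int b}"

text \<open>The bijection is \<open>walk\<close>. It starts at 0, so its second entry is
  \<open>w ! 0\<close>, and the letters are the signed differences of adjacent entries.\<close>

lemma card_based_arrangements:
  assumes "2 \<le> n"
  shows "card (based_arrangements a b n) =
    card {w. length w = n \<and> set w \<subseteq> letters a b \<and> w ! 0 = int a \<and> strong w}" (is "_ = card ?W")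
proof -
  have inj: "inj_on walk ?W"
    by (rule inj_onI) (auto intro: walk_inj)
  have img: "walk ` ?W = based_arrangements a b n"
  proof (intro subset_antisym subsetI)
    fix xs assume "xs \<in> walk ` ?W"
    then obtain w where w: "xs = walk w" "length w = n" "set w \<subseteq> letters a b" "w ! 0 = int a" "strong w"
      by auto
    have dist: "distinct xs" "set xs = {0..<n}"
      using walk_distinct_set[OF w(5)] w(1,2) by auto
    have "\<bar>int (xs ! i) - int (xs ! (Suc i mod n))\<bar> \<in> {int a, int b}" if i: "i < n" for i
    proof -
      have "xs ! i \<in> set xs" using i w(1,2) by (intro nth_mem) simp
      then have "xs ! i < n" using dist(2) by simp
      then have "w ! (xs ! i) \<in> letters a b" using w(2,3) nth_mem by blast
      then have "\<bar>w ! (xs ! i)\<bar> \<in> {int a, int b}" by (auto simp: letters_def)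
      then show ?thesis using walk_Suc_nth[OF w(5), of i] w(1,2) i by auto
    qed
    then have "xs \<in> arrangements a b n" using dist by (simp add: arrangements_def)
    moreover have "xs ! 0 = 0" using assms w(1,2) by (simp add: walk_def)
    moreover from this have "xs ! 1 = a"
      using walk_Suc_nth[OF w(5), of 0] w(1,2,4) assms by simp
    ultimately show "xs \<in> based_arrangements a b n" by (simp add: based_arrangements_def)
  next
    fix xs assume "xs \<in> based_arrangements a b n"
    then have xs: "xs \<in> arrangements a b n" and xs0: "xs ! 0 = 0" "xs ! 1 = a"
      by (auto simp: based_arrangements_def)
    note xs' = arrangementsD[OF xs]
    have "0 < n" using assms by simp
    then obtain w where w: "length w = n" "strong w" "walk w = xs"
      using walk_surj[OF xs'(1,2)] xs0(1) by blast
    have wn: "int (xs ! (Suc k mod n)) = int (xs ! k) + w ! (xs ! k)" if "k < n" for k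
      using walk_Suc_nth[OF w(2), of k] w that by simp
    have "set w \<subseteq> letters a b"
    proof
      fix c assume "c \<in> set w"
      then obtain v where v: "v < n" "c = w ! v" using w(1) by (auto simp: in_set_conv_nth)
      then have "v \<in> set xs" using xs'(2) by simp
      then obtain k where k: "k < n" "xs ! k = v" using xs'(3) by (auto simp: in_set_conv_nth)
      have "\<bar>c\<bar> \<in> {int a, int b}" using xs'(4)[OF k(1)] wn[OF k(1)] k(2) v(2) by simp
      then show "c \<in> letters a b" by (auto simp: letters_def abs_if split: if_splits)
    qed
    moreover have "w ! 0 = int a" using wn[of 0] xs0 assms by simp
    ultimately show "xs \<in> walk ` ?W" using w by blast
  qed
  show ?thesis
    using card_image[OF inj] unfolding img .
qed

text \<open>Splitting off the first \<open>b\<close> letters leaves only prefixes long enough for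
  the window to lie inside the word; since \<open>b\<close> is positive, the condition on the first
  letter concerns the prefix alone.\<close>

lemma card_strong_words:
  assumes "0 < b"
  shows "card {w. length w = b + k \<and> set w \<subseteq> letters a b \<and> w ! 0 = int a \<and> strong w} =
    (\<Sum>u | length u = b \<and> set u \<subseteq> letters a b \<and> u ! 0 = int a. card (extensions (letters a b) strong u k))"
    (is "card ?W = (\<Sum>u\<in>?U. _)")
proof -
  have fin: "finite (letters a b)" by (simp add: letters_def)
  have "?W = (\<Union>u\<in>?U. (@) u ` extensions (letters a b) strong u k)"
  proof (intro subset_antisym subsetI)
    fix w assume w: "w \<in> ?W"
    have "w = take b w @ drop b w" by simp
    moreover have "take b w \<in> ?U" using w assms by (auto dest: in_set_takeD)
    moreover have "drop b w \<in> extensions (letters a b) strong (take b w) k"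
      using w by (auto simp: extensions_def dest: in_set_dropD)
    ultimately show "w \<in> (\<Union>u\<in>?U. (@) u ` extensions (letters a b) strong u k)" by blast
  qed (use assms in \<open>auto simp: extensions_def nth_append\<close>)
  also have "card \<dots> = (\<Sum>u\<in>?U. card ((@) u ` extensions (letters a b) strong u k))"
  proof (rule card_UN_disjoint)
    show "finite ?U"
      by (rule finite_subset[OF _ finite_lists_length_eq[OF fin, of b]]) auto
  qed (auto simp: finite_extensions fin)
  also have "\<dots> = (\<Sum>u\<in>?U. card (extensions (letters a b) strong u k))"
    by (intro sum.cong refl card_image) (auto simp: inj_on_def)
  finally show ?thesis .
qed

text \<open>The pair of \<open>profile\<close> and \<open>anchored\<close> serves as the automaton
  state: it takes finitely many values, is updated letter by letter, and decides
  \<open>strong\<close>.\<close>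

lemma rational_fps_strong_extensions:
  assumes "0 < b" "A \<subseteq> {-b..b}" "set u \<subseteq> {-b..b}" "b \<le> int (length u)"
  shows "rational_fps (Abs_fps (\<lambda>k. int (card (extensions A strong u k))))"
proof -
  define U where "U = {u. set u \<subseteq> {-b..b} \<and> b \<le> int (length u)}"
  define s where "s = (\<lambda>u. (profile b u, anchored b u))"
  show ?thesis
  proof (rule rational_fps_extensions[of A s U])
    show "finite A" using assms(2) finite_subset by blast
    have "s ` U \<subseteq> Pow ({-b..b} \<times> {-b..b}) \<times> UNIV"
      by (auto simp: s_def profile_def)
    then show "finite (s ` U)"
      by (rule finite_subset) simp
    fix u v c assume "u \<in> U" "v \<in> U" "c \<in> A" "s u = s v"
    then have eq: "profile b u = profile b v" "anchored b u = anchored b v"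
      and words: "set u \<subseteq> {-b..b}" "set v \<subseteq> {-b..b}" "c \<in> {-b..b}"
      and len: "b \<le> int (length u)" "b \<le> int (length v)"
      using assms(2) by (auto simp only: s_def U_def prod.inject mem_Collect_eq)
    show "s (u @ [c]) = s (v @ [c])"
      using profile_snoc_cong[OF eq(1) words] anchored_snoc_cong[OF eq words len assms(1)]
      by (simp add: s_def)
  next
    fix u v assume "u \<in> U" "v \<in> U" "s u = s v"
    with assms(1) show "strong u = strong v"
      unfolding s_def U_def by (simp add: strong_iff_anchored[of b])
  qed (use assms in \<open>auto simp: U_def\<close>)
qed

theorem corollary4p12:
  fixes a b :: nat
  assumes "0 < a" and "a < b" and "coprime a b"
  shows "\<exists>(d :: nat) (n0 :: nat) (c :: nat \<Rightarrow> int).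
           1 \<le> d \<and> d + 3 \<le> n0 \<and>
           (\<forall>n\<ge>n0. int (num_necklaces a b n) =
                     (\<Sum>i=1..d. c i * int (num_necklaces a b (n - i))))"
proof -
  have b: "0 < b" using assms by simp
  let ?A = "letters a b" and ?U = "{u. length u = b \<and> set u \<subseteq> letters a b \<and> u ! 0 = int a}"
  have A: "?A \<subseteq> {-int b..int b}" using assms by (auto simp: letters_def)
  define f where "f = (\<Sum>u\<in>?U. Abs_fps (\<lambda>k. int (card (extensions ?A strong u k))))"
  have "rational_fps f"
    unfolding f_def
    by (intro rational_fps_sum rational_fps_strong_extensions[of "int b"]) (use A b in auto)
  then obtain d m c where rec:
      "\<And>n. m \<le> n \<Longrightarrow> d \<le> n \<and> fps_nth f n = (\<Sum>i=1..Suc d. c i * fps_nth f (n - i))"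
    using rational_fps_imp_recurrence by metis
  \<comment> \<open>Splitting off prefixes of length \<open>b\<close> shifts the index: coefficient
    \<open>k\<close> counts necklaces of length \<open>b + k\<close>.\<close>
  have f: "fps_nth f k = int (num_necklaces a b (b + k))" if "3 \<le> b + k" for k
    using that card_strong_words[OF b, of k a] card_based_arrangements[of "b + k" a b]
    by (simp add: num_necklaces_eq_card_based f_def fps_sum_nth)
  have "int (num_necklaces a b n) = (\<Sum>i=1..Suc d. c i * int (num_necklaces a b (n - i)))"
    \<comment> \<open>Here \<open>b\<close> undoes the index shift, \<open>m\<close> starts the
      recurrence for \<open>f\<close>, and \<open>d + 4\<close> keeps \<open>n - i\<close> at least
      3 for all \<open>i\<close> up to \<open>Suc d\<close>.\<close>
    if n: "b + m + d + 4 \<le> n" for n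
  proof -
    have "int (num_necklaces a b n) = fps_nth f (n - b)"
      using f[of "n - b"] n by simp
    also have "\<dots> = (\<Sum>i=1..Suc d. c i * fps_nth f (n - b - i))"
      using rec[of "n - b"] n by simp
    also have "\<dots> = (\<Sum>i=1..Suc d. c i * int (num_necklaces a b (n - i)))"
    proof (rule sum.cong)
      fix i assume "i \<in> {1..Suc d}"
      then have "b + (n - b - i) = n - i" using n by simp
      moreover have "3 \<le> b + (n - b - i)" using n \<open>i \<in> {1..Suc d}\<close> by auto
      ultimately show "c i * fps_nth f (n - b - i) = c i * int (num_necklaces a b (n - i))"
        using f[of "n - b - i"] by simp
    qed simp
    finally show ?thesis .
  qed
  then show ?thesis
    by (intro exI[of _ "Suc d"] exI[of _ "b + m + d + 4"] exI[of _ c]) auto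
qed

end
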